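(* Consider a channel $P_{Y|X}$ from a discrete alphabet $\mathcal X$ to a discrete alphabet $\mathcal Y$, and an ensemble of codes with $M$ codewords drawn according to some joint distribution $P_{X(1)X(2)\cdots X(M)}$ on $\mathcal X^M$ such that $$P_{X(\mathcal A)}=P_{X(\mathcal B)}\quad\text{for all ordered sets }\mathcal A,\mathcal B\subseteq[M]\text{ with }|\mathcal A|=|\mathcal B|.$$ Under ML decoding, the ensemble-average error probability $\epsilon$ satisfies $$\epsilon\le\mathbb E\left[\min\{1,(M-1)\Pr[i(\bar X;Y)\ge i(X;Y)\,|\,X,Y]\}\right],$$ where $$P_{X\bar XY}(a,b,c)=P_{X\bar X}(a,b)P_{Y|X}(c|a),\qquad P_{X\bar X}(a,b)=P_{X(1)X(2)}(a,b).$$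
   Context: $[M]=\{1,\dots,M\}$. For an ordered set $\mathcal A\subseteq[M]$, $X(\mathcal A)=(X(i):i\in\mathcal A)$. The information density is $i(x;y)=\log\frac{P_{Y|X}(y|x)}{P_Y(y)}$, where $P_Y$ is the output distribution induced by the common marginal $P_X=P_{X(1)}$ and $P_{Y|X}$. Messages are equiprobable on $[M]$; message $j$ is sent as $X(j)$; the ML decoder outputs a maximizer over $j$ of $P_{Y|X}(y|X(j))$, with ties broken uniformly at random. The ensemble-average error probability is the average error probability over messages, averaged over the random codebook. *)

theory Defs
  imports "HOL-Probability.Probability"
begin

text \<open>
  A channel is a Markov kernel \<open>W :: 'x \<Rightarrow> 'y pmf\<close>, so that \<open>pmf (W x) y\<close> is
  the probability of output \<open>y\<close> given input \<open>x\<close>. A codebook with \<open>M\<close> codewords is a function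
  \<open>C \<in> {1..M} \<rightarrow>\<^sub>E UNIV\<close>, and a code ensemble is a pmf on such functions.
\<close>

definition output_dist :: "'x pmf \<Rightarrow> ('x \<Rightarrow> 'y pmf) \<Rightarrow> 'y pmf" where
  "output_dist PX W = bind_pmf PX W"

text \<open>
  The information density takes extended real values: \<open>ln 0 = 0\<close> for reals in HOL, whereas here
  \<open>log 0 = -\<infinity>\<close>. The case of a zero denominator has probability zero whenever \<open>y\<close> is
  produced by an input distributed according to \<open>PX\<close>.
\<close>

definition info_density :: "'x pmf \<Rightarrow> ('x \<Rightarrow> 'y pmf) \<Rightarrow> 'x \<Rightarrow> 'y \<Rightarrow> ereal" where
  "info_density PX W x y =
    (if pmf (W x) y = 0 then - \<infinity>
     else if pmf (output_dist PX W) y = 0 then \<infinity>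
     else ereal (ln (pmf (W x) y / pmf (output_dist PX W) y)))"

definition ml_decoder :: "nat \<Rightarrow> ('x \<Rightarrow> 'y pmf) \<Rightarrow> (nat \<Rightarrow> 'x) \<Rightarrow> 'y \<Rightarrow> nat pmf" where
  "ml_decoder M W C y =
    pmf_of_set {j. is_arg_max (\<lambda>j. pmf (W (C j)) y) (\<lambda>j. j \<in> {1..M}) j}"

text \<open>The joint law of the transmitted and the decoded message for a fixed codebook.\<close>

definition transmission :: "nat \<Rightarrow> ('x \<Rightarrow> 'y pmf) \<Rightarrow> (nat \<Rightarrow> 'x) \<Rightarrow> (nat \<times> nat) pmf" where
  "transmission M W C =
    do {
      j \<leftarrow> pmf_of_set {1..M};
      y \<leftarrow> W (C j);
      k \<leftarrow> ml_decoder M W C y;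
      return_pmf (j, k)
    }"

definition ml_error_prob :: "nat \<Rightarrow> ('x \<Rightarrow> 'y pmf) \<Rightarrow> (nat \<Rightarrow> 'x) \<Rightarrow> real" where
  "ml_error_prob M W C = \<P>((j, k) in measure_pmf (transmission M W C). k \<noteq> j)"

definition ensemble_error_prob :: "nat \<Rightarrow> (nat \<Rightarrow> 'x) pmf \<Rightarrow> ('x \<Rightarrow> 'y pmf) \<Rightarrow> real" where
  "ensemble_error_prob M P W = measure_pmf.expectation P (ml_error_prob M W)"

text \<open>
  Ordered subsets of \<open>[M]\<close> are lists of distinct indices in an arbitrary (not necessarily
  increasing) order; \<open>map C as\<close> is the tuple of the codewords of \<open>C\<close> indexed by \<open>as\<close>.
\<close>

definition symmetric_ensemble :: "nat \<Rightarrow> (nat \<Rightarrow> 'x) pmf \<Rightarrow> bool" where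
  "symmetric_ensemble M P \<longleftrightarrow>
    (\<forall>as bs. distinct as \<and> set as \<subseteq> {1..M} \<and> distinct bs \<and> set bs \<subseteq> {1..M} \<and>
       length as = length bs \<longrightarrow>
       map_pmf (\<lambda>C. map C as) P = map_pmf (\<lambda>C. map C bs) P)"

text \<open>
  The joint law of \<open>(X, X', Y)\<close>, where \<open>(X, X')\<close> is distributed as the first two codewords and
  \<open>Y\<close> is the channel output for the input \<open>X\<close>.
\<close>

definition joint_XXY :: "(nat \<Rightarrow> 'x) pmf \<Rightarrow> ('x \<Rightarrow> 'y pmf) \<Rightarrow> ('x \<times> 'x \<times> 'y) pmf" where
  "joint_XXY P W =
    do {
      (a, b) \<leftarrow> map_pmf (\<lambda>C. (C 1, C 2)) P;
      c \<leftarrow> W a;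
      return_pmf (a, b, c)
    }"

end

theory Submission
  imports Defs
begin

text \<open>
  An ML error for message \<open>j\<close> requires a competing codeword that is at least as likely as
  \<open>C j\<close>. The union bound over the competitors is applied conditionally on the pair
  \<open>(C j, y)\<close> of the sent codeword and the output, which leaves the minimum with \<open>1\<close> inside
  the expectation. By symmetry \<open>(C j, C k, y)\<close> has the same law for all \<open>j \<noteq> k\<close>, so the
  \<open>M - 1\<close> conditional probabilities coincide. Given the output, the information density is
  increasing in the likelihood.
\<close>

section \<open>Conditional probabilities for discrete laws\<close>

lemma measure_bind_pmf:
  "measure (bind_pmf p f) A = measure_pmf.expectation p (\<lambda>x. measure (f x) A)"
proof -
  have "integrable (measure_pmf p) (\<lambda>x. measure (f x) A)"
    by (intro measure_pmf.integrable_const_bound[where B=1]) auto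
  then have "ennreal (measure (bind_pmf p f) A)
      = ennreal (measure_pmf.expectation p (\<lambda>x. measure (f x) A))"
    by (simp add: measure_pmf.emeasure_eq_measure[symmetric] nn_integral_eq_integral[symmetric])
  then show ?thesis
    by (simp add: integral_nonneg_AE)
qed

lemma expectation_mono_pmf:
  fixes f g :: "'a \<Rightarrow> real"
  assumes "\<And>x. x \<in> set_pmf p \<Longrightarrow> 0 \<le> f x" "\<And>x. x \<in> set_pmf p \<Longrightarrow> f x \<le> g x"
    and "\<And>x. x \<in> set_pmf p \<Longrightarrow> g x \<le> 1"
  shows "measure_pmf.expectation p f \<le> measure_pmf.expectation p g"
proof (rule integral_mono_AE)
  have "\<bar>f x\<bar> \<le> 1" "\<bar>g x\<bar> \<le> 1" if "x \<in> set_pmf p" for x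
    using assms(1-3)[OF that] by linarith+
  then show "integrable (measure_pmf p) f" "integrable (measure_pmf p) g"
    by (auto intro!: measure_pmf.integrable_const_bound[where B=1] AE_pmfI)
qed (use assms in \<open>auto intro: AE_pmfI\<close>)

lemma measure_cond_pmf:
  assumes "set_pmf p \<inter> B \<noteq> {}"
  shows "measure (cond_pmf p B) A = measure p (B \<inter> A) / measure p B"
  using assms
  by (simp add: cond_pmf.rep_eq[OF assms] emeasure_measure_pmf_not_zero[OF assms])

text \<open>Law of total probability: \<open>p\<close> is the mixture, over the law of
  \<open>g\<close>, of its conditionings on \<open>g \<omega> = z\<close>. It allows a bound to be
  applied, and cut off at 1, separately for each value \<open>z\<close>.\<close>

lemma prob_eq_expectation_cond_prob:
  "\<P>(\<omega> in measure_pmf p. E \<omega>) =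
    measure_pmf.expectation (map_pmf g p) (\<lambda>z. \<P>(\<omega> in measure_pmf p. E \<omega> \<bar> g \<omega> = z))"
proof -
  have "p = bind_pmf (map_pmf g p) (\<lambda>z. cond_pmf p {\<omega>. g \<omega> = z})"
    by (rule sym, rule bind_cond_pmf_cancel) (auto intro!: arg_cong2[where f=measure])
  then have "\<P>(\<omega> in measure_pmf p. E \<omega>)
      = measure (bind_pmf (map_pmf g p) (\<lambda>z. cond_pmf p {\<omega>. g \<omega> = z})) {\<omega>. E \<omega>}"
    by simp
  also have "\<dots> = measure_pmf.expectation (map_pmf g p)
      (\<lambda>z. measure (cond_pmf p {\<omega>. g \<omega> = z}) {\<omega>. E \<omega>})"
    by (rule measure_bind_pmf)
  also have "\<dots> = measure_pmf.expectation (map_pmf g p)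
      (\<lambda>z. \<P>(\<omega> in measure_pmf p. E \<omega> \<bar> g \<omega> = z))"
  proof (rule integral_cong_AE)
    \<comment> \<open>Outside the support of \<open>g\<close> the law \<open>cond_pmf\<close> is
      unspecified, so the integrands are compared almost everywhere only.\<close>
    show "AE z in measure_pmf (map_pmf g p). measure (cond_pmf p {\<omega>. g \<omega> = z}) {\<omega>. E \<omega>}
        = \<P>(\<omega> in measure_pmf p. E \<omega> \<bar> g \<omega> = z)"
    proof (rule AE_pmfI)
      fix z assume "z \<in> set_pmf (map_pmf g p)"
      then have "set_pmf p \<inter> {\<omega>. g \<omega> = z} \<noteq> {}" by auto
      then show "measure (cond_pmf p {\<omega>. g \<omega> = z}) {\<omega>. E \<omega>}
          = \<P>(\<omega> in measure_pmf p. E \<omega> \<bar> g \<omega> = z)"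
        by (simp add: measure_cond_pmf cond_prob_def Int_def conj_commute)
    qed
  qed auto
  finally show ?thesis .
qed

lemma cond_prob_map_pmf:
  "\<P>(\<omega> in measure_pmf (map_pmf f p). A \<omega> \<bar> B \<omega>)
    = \<P>(\<omega> in measure_pmf p. A (f \<omega>) \<bar> B (f \<omega>))"
  by (simp add: cond_prob_def vimage_def)

lemma cond_prob_le_1: "\<P>(\<omega> in measure_pmf p. A \<omega> \<bar> B \<omega>) \<le> 1"
proof -
  have "measure p {\<omega>. A \<omega> \<and> B \<omega>} \<le> measure p {\<omega>. B \<omega>}"
    by (rule measure_pmf.finite_measure_mono) auto
  then show ?thesis
    by (cases "measure p {\<omega>. B \<omega>} = 0") (auto simp: cond_prob_def divide_le_eq_1 less_le)
qed

text \<open>Subadditivity, divided by the probability of \<open>B\<close>. If \<open>B\<close> is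
  null, all terms are 0 because division by zero gives 0.\<close>

lemma cond_prob_union_bound:
  assumes "finite K"
  shows "\<P>(\<omega> in measure_pmf p. \<exists>k\<in>K. A k \<omega> \<bar> B \<omega>)
    \<le> (\<Sum>k\<in>K. \<P>(\<omega> in measure_pmf p. A k \<omega> \<bar> B \<omega>))"
proof -
  have "{\<omega>. (\<exists>k\<in>K. A k \<omega>) \<and> B \<omega>} = (\<Union>k\<in>K. {\<omega>. A k \<omega> \<and> B \<omega>})" by auto
  then have "measure p {\<omega>. (\<exists>k\<in>K. A k \<omega>) \<and> B \<omega>} \<le> (\<Sum>k\<in>K. measure p {\<omega>. A k \<omega> \<and> B \<omega>})"
    using assms by (simp add: measure_pmf.finite_measure_subadditive_finite)
  then show ?thesis
    by (simp add: cond_prob_def sum_divide_distrib[symmetric] divide_right_mono)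
qed

text \<open>For a fixed output both densities have the same positive denominator, and
  \<open>ln\<close> is increasing. If \<open>x'\<close> cannot produce \<open>y\<close>, its density
  is \<open>- \<infinity>\<close> while that of \<open>x\<close> is finite, and both comparisons
  fail.\<close>

lemma info_density_le_iff:
  assumes "pmf (W x) y > 0" "pmf (output_dist PX W) y > 0"
  shows "info_density PX W x y \<le> info_density PX W x' y \<longleftrightarrow> pmf (W x) y \<le> pmf (W x') y"
proof (cases "pmf (W x') y = 0")
  case False
  then have "pmf (W x') y > 0" by simp
  with assms show ?thesis by (simp add: info_density_def divide_le_cancel)
qed (use assms in \<open>simp add: info_density_def\<close>)

section \<open>Codebook and channel output given the sent message\<close>

text \<open>The whole codebook is kept, so that the events of all competitors live on one
  probability space.\<close>

definition sent_received :: "(nat \<Rightarrow> 'x) pmf \<Rightarrow> ('x \<Rightarrow> 'y pmf) \<Rightarrow> nat \<Rightarrow> ((nat \<Rightarrow> 'x) \<times> 'y) pmf" where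
  "sent_received P W j = bind_pmf P (\<lambda>C. map_pmf (Pair C) (W (C j)))"

lemma symmetric_ensemble_one:
  assumes "symmetric_ensemble M P" "j \<in> {1..M}"
  shows "map_pmf (\<lambda>C. C j) P = map_pmf (\<lambda>C. C 1) P"
proof -
  have "map_pmf (\<lambda>C. map C [j]) P = map_pmf (\<lambda>C. map C [1]) P"
    using assms unfolding symmetric_ensemble_def by (elim allE[of _ "[j]"] allE[of _ "[1]"]) auto
  then have "map_pmf hd (map_pmf (\<lambda>C. map C [j]) P) = map_pmf hd (map_pmf (\<lambda>C. map C [1]) P)"
    by simp
  then show ?thesis by (simp add: pmf.map_comp o_def)
qed

lemma symmetric_ensemble_two:
  assumes "symmetric_ensemble M P" "j \<in> {1..M}" "k \<in> {1..M}" "j \<noteq> k"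
  shows "map_pmf (\<lambda>C. (C j, C k)) P = map_pmf (\<lambda>C. (C 1, C 2)) P"
proof -
  have "map_pmf (\<lambda>C. map C [j, k]) P = map_pmf (\<lambda>C. map C [1, 2]) P"
    \<comment> \<open>Two distinct indices in \<open>{1..M}\<close> force \<open>M \<ge> 2\<close>,
      so \<open>[1, 2]\<close> is an admissible index list.\<close>
    using assms unfolding symmetric_ensemble_def
    by (elim allE[of _ "[j, k]"] allE[of _ "[1, 2]"]) auto
  then have "map_pmf (\<lambda>l. (l ! 0, l ! 1)) (map_pmf (\<lambda>C. map C [j, k]) P)
      = map_pmf (\<lambda>l. (l ! 0, l ! 1)) (map_pmf (\<lambda>C. map C [1, 2]) P)"
    by simp
  then show ?thesis by (simp add: pmf.map_comp o_def)
qed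

text \<open>Pairwise symmetry lets any competitor \<open>k\<close> of any sent \<open>j\<close> play
  the role of the independent-of-index pair \<open>(1, 2)\<close>; this is what makes the summands
  of the union bound equal.\<close>

lemma joint_XXY_eq_map_sent_received:
  assumes "symmetric_ensemble M P" "j \<in> {1..M}" "k \<in> {1..M}" "j \<noteq> k"
  shows "joint_XXY P W = map_pmf (\<lambda>(C, y). (C j, C k, y)) (sent_received P W j)"
proof -
  have "joint_XXY P W = bind_pmf (map_pmf (\<lambda>C. (C j, C k)) P)
      (\<lambda>(a, b). bind_pmf (W a) (\<lambda>c. return_pmf (a, b, c)))"
    unfolding joint_XXY_def symmetric_ensemble_two[OF assms] ..
  then show ?thesis
    by (simp add: sent_received_def bind_map_pmf map_bind_pmf pmf.map_comp o_def map_pmf_def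
        bind_assoc_pmf bind_return_pmf)
qed

text \<open>Only one codeword is involved, so symmetry for single indices suffices. This also covers
  \<open>M = 1\<close>, where no competitor exists and the second component is projected
  away.\<close>

lemma marginal_sent_received:
  assumes "symmetric_ensemble M P" "j \<in> {1..M}"
  shows "map_pmf (\<lambda>(C, y). (C j, y)) (sent_received P W j)
    = map_pmf (\<lambda>(x, _, y). (x, y)) (joint_XXY P W)"
proof -
  have "map_pmf (\<lambda>(C, y). (C j, y)) (sent_received P W j)
      = bind_pmf (map_pmf (\<lambda>C. C j) P) (\<lambda>x. map_pmf (Pair x) (W x))"
    by (simp add: sent_received_def bind_map_pmf map_bind_pmf pmf.map_comp o_def)
  also have "\<dots> = bind_pmf (map_pmf (\<lambda>C. C 1) P) (\<lambda>x. map_pmf (Pair x) (W x))"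
    unfolding symmetric_ensemble_one[OF assms] ..
  also have "\<dots> = map_pmf (\<lambda>(x, _, y). (x, y)) (joint_XXY P W)"
    by (simp add: joint_XXY_def map_pmf_def bind_assoc_pmf bind_return_pmf)
  finally show ?thesis .
qed

section \<open>From decoding errors to the event of a competitor\<close>

text \<open>If every competitor is strictly less likely, \<open>j\<close> is the unique maximizer
  and is decoded surely. Otherwise the bound is 1, so every tie is counted as an error.\<close>

lemma ml_decoder_error_le:
  assumes "j \<in> {1..M}"
  shows "measure (ml_decoder M W C y) {k. k \<noteq> j}
    \<le> of_bool (\<exists>k\<in>{1..M} - {j}. pmf (W (C j)) y \<le> pmf (W (C k)) y)"
    (is "_ \<le> of_bool ?E")
proof (cases ?E)
  case False
  then have strict: "pmf (W (C k)) y < pmf (W (C j)) y" if "k \<in> {1..M}" "k \<noteq> j" for k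
    using that by (meson Diff_iff not_le singletonD)
  have "is_arg_max (\<lambda>k. pmf (W (C k)) y) (\<lambda>k. k \<in> {1..M}) k \<longleftrightarrow> k = j" for k
    unfolding is_arg_max_def using strict assms by (metis less_asym)
  then show ?thesis by (simp add: ml_decoder_def pmf_of_set_singleton)
qed simp

lemma ensemble_error_prob_le:
  assumes "M \<ge> 1"
    and "\<And>j. j \<in> {1..M} \<Longrightarrow> \<P>((C, y) in measure_pmf (sent_received P W j).
      \<exists>k\<in>{1..M} - {j}. pmf (W (C j)) y \<le> pmf (W (C k)) y) \<le> b"
  shows "ensemble_error_prob M P W \<le> b"
proof -
  define out where "out j = (\<lambda>(C, y). map_pmf (Pair j) (ml_decoder M W C y))" for j :: nat
  have set: "set_pmf (pmf_of_set {1..M}) = {1..M}"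
    using assms(1) by simp
  have "ml_error_prob M W = (\<lambda>C. measure (transmission M W C) {(j, k). k \<noteq> j})"
    by (simp add: ml_error_prob_def fun_eq_iff)
  then have "ensemble_error_prob M P W = measure (bind_pmf P (transmission M W)) {(j, k). k \<noteq> j}"
    by (simp add: ensemble_error_prob_def measure_bind_pmf)
  also have "bind_pmf P (transmission M W)
      = bind_pmf (pmf_of_set {1..M}) (\<lambda>j. bind_pmf (sent_received P W j) (out j))"
    unfolding transmission_def
    \<comment> \<open>Message and codebook are drawn independently, so the message may be drawn
      first.\<close>
    by (subst bind_commute_pmf)
       (simp add: sent_received_def out_def bind_assoc_pmf bind_map_pmf map_pmf_def bind_return_pmf)
  also have "measure \<dots> {(j, k). k \<noteq> j} = measure_pmf.expectation (pmf_of_set {1..M})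
      (\<lambda>j. measure (bind_pmf (sent_received P W j) (out j)) {(j, k). k \<noteq> j})"
    by (rule measure_bind_pmf)
  also have "\<dots> \<le> measure_pmf.expectation (pmf_of_set {1..M}) (\<lambda>j. b)"
  proof (rule integral_mono_AE)
    show "AE j in measure_pmf (pmf_of_set {1..M}).
      measure (bind_pmf (sent_received P W j) (out j)) {(j, k). k \<noteq> j} \<le> b"
    proof (rule AE_pmfI)
      fix j assume "j \<in> set_pmf (pmf_of_set {1..M})"
      then have j: "j \<in> {1..M}" by (simp only: set)
      define E where
        "E = (\<lambda>(C, y). \<exists>k\<in>{1..M} - {j}. pmf (W (C j)) y \<le> pmf (W (C k)) y)"
      have "measure (bind_pmf (sent_received P W j) (out j)) {(j, k). k \<noteq> j}
          = measure_pmf.expectation (sent_received P W j)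
              (\<lambda>\<omega>. measure (out j \<omega>) {(j, k). k \<noteq> j})"
        by (rule measure_bind_pmf)
      also have "\<dots> \<le> measure_pmf.expectation (sent_received P W j) (indicator {\<omega>. E \<omega>})"
      proof (rule expectation_mono_pmf)
        fix \<omega>
        show "measure (out j \<omega>) {(j, k). k \<noteq> j} \<le> indicator {\<omega>. E \<omega>} \<omega>"
          using ml_decoder_error_le[OF j, of W "fst \<omega>" "snd \<omega>"]
          by (simp add: out_def E_def vimage_def indicator_def split_def)
      qed (simp_all add: indicator_def)
      also have "\<dots> \<le> b"
        using assms(2)[OF j] by (simp add: E_def)
      finally show "measure (bind_pmf (sent_received P W j) (out j)) {(j, k). k \<noteq> j} \<le> b" .
    qed
  qed (auto intro!: measure_pmf.integrable_const_bound[where B=1])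
  finally show ?thesis by simp
qed

section \<open>The conditional union bound\<close>

lemma sent_received_union_bound:
  fixes W :: "'x \<Rightarrow> 'y pmf"
  assumes "symmetric_ensemble M P" "j \<in> {1..M}"
  defines "i \<equiv> info_density (map_pmf (\<lambda>C. C 1) P) W"
  shows "\<P>((C, y) in measure_pmf (sent_received P W j).
      \<exists>k\<in>{1..M} - {j}. pmf (W (C j)) y \<le> pmf (W (C k)) y)
    \<le> measure_pmf.expectation (joint_XXY P W) (\<lambda>(x, _, y).
      min 1 ((real M - 1) *
        \<P>((x', xbar, y') in measure_pmf (joint_XXY P W).
          i xbar y' \<ge> i x' y' \<bar> x' = x \<and> y' = y)))"
proof -
  let ?D = "measure_pmf (sent_received P W j)"
  define f where "f = (\<lambda>(x, y). \<P>((x', xbar, y') in measure_pmf (joint_XXY P W).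
          i xbar y' \<ge> i x' y' \<bar> x' = x \<and> y' = y))"
  define g where "g = (\<lambda>(C, y :: 'y). (C j :: 'x, y))"
  define A where "A k = (\<lambda>(C, y). pmf (W (C j)) y \<le> pmf (W (C k)) y)" for k
  have out: "pmf (W x) y > 0" "pmf (output_dist (map_pmf (\<lambda>C. C 1) P) W) y > 0"
    if "(x, y) \<in> set_pmf (map_pmf g (sent_received P W j))" for x y
  proof -
    from that obtain C where "C \<in> set_pmf P" "x = C j" "y \<in> set_pmf (W x)"
      by (auto simp: g_def sent_received_def)
    \<comment> \<open>The output distribution is built from the law of \<open>C 1\<close>; by
      symmetry the sent codeword \<open>C j\<close> has that law too.\<close>
    moreover from this have "x \<in> set_pmf (map_pmf (\<lambda>C. C 1) P)"
      unfolding symmetric_ensemble_one[OF assms(1,2), symmetric] by auto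
    ultimately show "pmf (W x) y > 0" "pmf (output_dist (map_pmf (\<lambda>C. C 1) P) W) y > 0"
      by (force simp: output_dist_def pmf_positive_iff)+
  qed
  have info_density_le: "i x y \<le> i x' y \<longleftrightarrow> pmf (W x) y \<le> pmf (W x') y"
    if "(x, y) \<in> set_pmf (map_pmf g (sent_received P W j))" for x y x'
    unfolding i_def by (rule info_density_le_iff[OF out[OF that]])
  have pairwise: "\<P>(\<omega> in ?D. A k \<omega> \<bar> g \<omega> = (x, y)) = f (x, y)"
    if xy: "(x, y) \<in> set_pmf (map_pmf g (sent_received P W j))" and k: "k \<in> {1..M} - {j}" for x y k
  proof -
    have "f (x, y) = \<P>((C, y') in ?D. i (C k) y' \<ge> i (C j) y' \<bar> C j = x \<and> y' = y)"
      using k joint_XXY_eq_map_sent_received[OF assms(1,2), of k W]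
      by (simp add: f_def cond_prob_map_pmf split_def)
    also have "\<dots> = \<P>(\<omega> in ?D. A k \<omega> \<bar> g \<omega> = (x, y))"
      \<comment> \<open>Both numerators are restricted to \<open>g \<omega> = (x, y)\<close>, so
        comparing densities with likelihoods at this one point of the support is enough.\<close>
      unfolding cond_prob_def
      by (intro arg_cong2[where f="(/)"] arg_cong2[where f=measure])
         (use xy info_density_le in \<open>auto simp only: A_def g_def prod.case prod.inject\<close>)
    finally show ?thesis by simp
  qed
  have "\<P>(\<omega> in ?D. \<exists>k\<in>{1..M} - {j}. A k \<omega>)
      = measure_pmf.expectation (map_pmf g (sent_received P W j))
          (\<lambda>z. \<P>(\<omega> in ?D. \<exists>k\<in>{1..M} - {j}. A k \<omega> \<bar> g \<omega> = z))"
    by (rule prob_eq_expectation_cond_prob)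
  also have "\<dots> \<le> measure_pmf.expectation (map_pmf g (sent_received P W j))
      (\<lambda>z. min 1 ((real M - 1) * f z))"
  proof (rule expectation_mono_pmf)
    fix z assume z: "z \<in> set_pmf (map_pmf g (sent_received P W j))"
    have "\<P>(\<omega> in ?D. \<exists>k\<in>{1..M} - {j}. A k \<omega> \<bar> g \<omega> = z)
        \<le> (\<Sum>k\<in>{1..M} - {j}. \<P>(\<omega> in ?D. A k \<omega> \<bar> g \<omega> = z))"
      by (rule cond_prob_union_bound) simp
    also have "\<dots> = (\<Sum>k\<in>{1..M} - {j}. f z)"
      using pairwise z by (cases z) (intro sum.cong, auto)
    \<comment> \<open>Since \<open>j\<close> lies in \<open>{1..M}\<close>, exactly
      \<open>M - 1\<close> competitors remain.\<close>
    also have "\<dots> = (real M - 1) * f z"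
      using assms(2) by simp
    finally show "\<P>(\<omega> in ?D. \<exists>k\<in>{1..M} - {j}. A k \<omega> \<bar> g \<omega> = z)
        \<le> min 1 ((real M - 1) * f z)"
      by (simp add: cond_prob_le_1)
  qed (simp_all add: cond_prob_def)
  \<comment> \<open>The integrand depends on the sent codeword and the output alone, and their law
    is a marginal of \<open>joint_XXY P W\<close>.\<close>
  also have "\<dots> = measure_pmf.expectation (joint_XXY P W)
      (\<lambda>(x, _, y). min 1 ((real M - 1) * f (x, y)))"
    unfolding g_def marginal_sent_received[OF assms(1,2)] by (simp add: split_def)
  finally show ?thesis
    by (simp add: A_def f_def split_def)
qed

theorem theorem10:
  fixes M :: nat
    and W :: "'x \<Rightarrow> 'y pmf"
    and P :: "(nat \<Rightarrow> 'x) pmf"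
    and i :: "'x \<Rightarrow> 'y \<Rightarrow> ereal"
  assumes "M \<ge> 1"
    and "set_pmf P \<subseteq> {1..M} \<rightarrow>\<^sub>E UNIV"
    and "symmetric_ensemble M P"
  defines "i \<equiv> info_density (map_pmf (\<lambda>C. C 1) P) W"
  shows "ensemble_error_prob M P W \<le>
    measure_pmf.expectation (joint_XXY P W) (\<lambda>(x, _, y).
      min 1 ((real M - 1) *
        \<P>((x', xbar, y') in measure_pmf (joint_XXY P W).
          i xbar y' \<ge> i x' y' \<bar> x' = x \<and> y' = y)))"
  \<comment> \<open>The right-hand side does not depend on the sent message, so it serves as the
    common bound \<open>b\<close>.\<close>
  unfolding i_def
  by (rule ensemble_error_prob_le[OF assms(1) sent_received_union_bound[OF assms(3)]])

end
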